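(* Let $A\in\mathbb{R}^{n\times n}$ be diagonalizable, $A=PDP^{-1}$ with $P\in\mathbb{C}^{n\times n}$ invertible and $D\in\mathbb{C}^{n\times n}$ diagonal with diagonal entries $d_{11},\dots,d_{nn}$, and suppose every eigenvalue of $A$ is simple. Let $b,c\in\mathbb{R}^n$ be such that $c^T(A-sI)^{-1}b\neq 0$ for all $s\in\mathbb{C}\setminus\lambda(A)$ and $c^TPe_k\,e_k^TP^{-1}b\neq 0$ for $k=1,\dots,n$. Let $1\le p\le n$ and let $\lambda_1,\dots,\lambda_p$ be $p$ distinct eigenvalues of $A$. Then there is a neighborhood $V$ of $(\lambda_1,\dots,\lambda_p)^T$ in $\mathbb{C}^p$ such that, for any $S_0\in V$, the Diagonal Dominant Pole Spectrum Eigensolver (DDPSE) iteration $S_{r+1}=H(S_r)$, $r\ge 0$, started at $S_0$ converges at least quadratically to $(\lambda_1,\dots,\lambda_p)^T$, where $H$ is the DDPSE map defined in the context.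
   Context: $\lambda(A)$ denotes the spectrum of $A$, $e_1,e_2,\dots$ are the canonical basis vectors (of the appropriate dimension), and $^T$ is the plain transpose (no conjugation). With $A=PDP^{-1}$, $b$, $c$ as in the claim, define $f,g:\mathbb{C}\to\mathbb{C}^n$ by $$f(s)=\frac{(A-sI)^{-1}b}{c^T(A-sI)^{-1}b}\ \text{ for } s\in\mathbb{C}\setminus\lambda(A),\qquad f(d_{jj})=\frac{Pe_j}{c^TPe_j},\quad j=1,\dots,n,$$ $$g(s)=\frac{(A^T-sI)^{-1}c}{c^T(A-sI)^{-1}b}\ \text{ for } s\in\mathbb{C}\setminus\lambda(A),\qquad g(d_{jj})=\frac{P^{-T}e_j}{b^TP^{-T}e_j},\quad j=1,\dots,n,$$ where $P^{-T}=(P^{-1})^T$. For $S=(s_1,\dots,s_p)^T\in\mathbb{C}^p$, $X(S),Y(S)\in\mathbb{C}^{n\times p}$ are the matrices whose $k$-th columns are $X(S)e_k=f(s_k)$ and $Y(S)e_k=g(s_k)$, $k=1,\dots,p$. Wherever $Y(S)^TX(S)$ is invertible (which holds on an open neighborhood of $(\lambda_1,\dots,\lambda_p)^T$), put $$F(S)=\left(Y(S)^TX(S)\right)^{-1}\left(Y(S)^TAX(S)\right)\in\mathbb{C}^{p\times p}.$$ DDPSE is the fixed-point iteration applied to the map $H$ with values in $\mathbb{C}^p$ given by $H(S)=\mathrm{diag}(F(S))$, the vector of diagonal entries of $F(S)$. When $s_i\notin\lambda(A)$ for all $i$, this equals $$H(S)=S+\mathrm{diag}\left(\frac{1}{c^T(A-s_1I)^{-1}b},\dots,\frac{1}{c^T(A-s_pI)^{-1}b}\right)\left(Y(S)^TX(S)\right)^{-1}e,$$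 where $e=(1,\dots,1)^T\in\mathbb{R}^p$ and $\mathrm{diag}(\cdot,\dots,\cdot)$ denotes the diagonal matrix with the given entries; and $H\left((\mu_1,\dots,\mu_p)^T\right)=(\mu_1,\dots,\mu_p)^T$ for every $p$-tuple of distinct eigenvalues $\mu_1,\dots,\mu_p$ of $A$. "Converges at least quadratically to $S^*$" means that all iterates are well defined, $S_r\to S^*$, and there is a constant $C$ with $\|S_{r+1}-S^*\|\le C\|S_r-S^*\|^2$ for all $r\ge 0$. *)

theory Defs
  imports "HOL-Analysis.Analysis" "HOL-Computational_Algebra.Polynomial"
begin

definition cvec :: "real^'n \<Rightarrow> complex^'n" where
  "cvec v = (\<chi> i. complex_of_real (v $ i))"

abbreviation cmat :: "real^'n^'m \<Rightarrow> complex^'n^'m" where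
  "cmat \<equiv> map_matrix complex_of_real"

definition eigenvalues :: "complex^'n^'n \<Rightarrow> complex set" where
  "eigenvalues A = {s. \<exists>v. v \<noteq> 0 \<and> A *v v = s *s v}"

(* det (x I - A), as a determinant over the polynomial ring *)
definition charpoly :: "complex^'n^'n \<Rightarrow> complex poly" where
  "charpoly A = det (mat [:0, 1:] - map_matrix (\<lambda>a. [:a:]) A)"

definition simple_eigenvalue :: "complex^'n^'n \<Rightarrow> complex \<Rightarrow> bool" where
  "simple_eigenvalue A s \<longleftrightarrow> s \<in> eigenvalues A \<and> order s (charpoly A) = 1"

definition diagonal :: "complex^'n^'n \<Rightarrow> bool" where
  "diagonal D \<longleftrightarrow> (\<forall>i j. i \<noteq> j \<longrightarrow> D $ i $ j = 0)"

(* c^T (A - s I)^{-1} b. Note that scalar_product is bilinear: unlike the complex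
   inner product there is no conjugation. Note also that mat s is s I. *)
definition transfer_fun ::
  "complex^'n^'n \<Rightarrow> complex^'n \<Rightarrow> complex^'n \<Rightarrow> complex \<Rightarrow> complex" where
  "transfer_fun A b c s = scalar_product c (matrix_inv (A - mat s) *v b)"

(* At an eigenvalue, j is the index with s = d_jj; it is unique when all eigenvalues
   of A = P D P^{-1} are simple. *)
definition ddpse_f ::
  "complex^'n^'n \<Rightarrow> complex^'n^'n \<Rightarrow> complex^'n^'n \<Rightarrow> complex^'n \<Rightarrow> complex^'n
    \<Rightarrow> complex \<Rightarrow> complex^'n" where
  "ddpse_f A P D b c s =
    (if s \<in> eigenvalues A
     then let v = P *v axis (THE j. D $ j $ j = s) 1 in (1 / scalar_product c v) *s v
     else (1 / transfer_fun A b c s) *s (matrix_inv (A - mat s) *v b))"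

definition ddpse_g ::
  "complex^'n^'n \<Rightarrow> complex^'n^'n \<Rightarrow> complex^'n^'n \<Rightarrow> complex^'n \<Rightarrow> complex^'n
    \<Rightarrow> complex \<Rightarrow> complex^'n" where
  "ddpse_g A P D b c s =
    (if s \<in> eigenvalues A
     then let w = transpose (matrix_inv P) *v axis (THE j. D $ j $ j = s) 1
          in (1 / scalar_product b w) *s w
     else (1 / transfer_fun A b c s) *s (matrix_inv (transpose A - mat s) *v c))"

definition ddpse_X ::
  "complex^'n^'n \<Rightarrow> complex^'n^'n \<Rightarrow> complex^'n^'n \<Rightarrow> complex^'n \<Rightarrow> complex^'n
    \<Rightarrow> complex^'p \<Rightarrow> complex^'p^'n" where
  "ddpse_X A P D b c S = (\<chi> i k. ddpse_f A P D b c (S $ k) $ i)"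

definition ddpse_Y ::
  "complex^'n^'n \<Rightarrow> complex^'n^'n \<Rightarrow> complex^'n^'n \<Rightarrow> complex^'n \<Rightarrow> complex^'n
    \<Rightarrow> complex^'p \<Rightarrow> complex^'p^'n" where
  "ddpse_Y A P D b c S = (\<chi> i k. ddpse_g A P D b c (S $ k) $ i)"

(* The set on which F and H are defined; matrix_inv is a junk value elsewhere. *)
definition ddpse_domain ::
  "complex^'n^'n \<Rightarrow> complex^'n^'n \<Rightarrow> complex^'n^'n \<Rightarrow> complex^'n \<Rightarrow> complex^'n
    \<Rightarrow> (complex^'p) set" where
  "ddpse_domain A P D b c =
    {S. invertible (transpose (ddpse_Y A P D b c S) ** ddpse_X A P D b c S)}"

definition ddpse_F ::
  "complex^'n^'n \<Rightarrow> complex^'n^'n \<Rightarrow> complex^'n^'n \<Rightarrow> complex^'n \<Rightarrow> complex^'n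
    \<Rightarrow> complex^'p \<Rightarrow> complex^'p^'p" where
  "ddpse_F A P D b c S =
    matrix_inv (transpose (ddpse_Y A P D b c S) ** ddpse_X A P D b c S)
      ** (transpose (ddpse_Y A P D b c S) ** A ** ddpse_X A P D b c S)"

definition ddpse_H ::
  "complex^'n^'n \<Rightarrow> complex^'n^'n \<Rightarrow> complex^'n^'n \<Rightarrow> complex^'n \<Rightarrow> complex^'n
    \<Rightarrow> complex^'p \<Rightarrow> complex^'p" where
  "ddpse_H A P D b c S = (\<chi> k. ddpse_F A P D b c S $ k $ k)"

(* The fixed-point iteration of a partial map H with domain U, started at x0,
   is well defined for all steps and converges at least quadratically to l. *)
definition iteration_converges_quadratically ::
  "('a::real_normed_vector) set \<Rightarrow> ('a \<Rightarrow> 'a) \<Rightarrow> 'a \<Rightarrow> 'a \<Rightarrow> bool" where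
  "iteration_converges_quadratically U H x0 l \<longleftrightarrow>
    (\<forall>r. (H ^^ r) x0 \<in> U) \<and>
    (\<lambda>r. (H ^^ r) x0) \<longlonglongrightarrow> l \<and>
    (\<exists>C. \<forall>r. norm ((H ^^ Suc r) x0 - l) \<le> C * (norm ((H ^^ r) x0 - l))\<^sup>2)"

end

theory Submission
  imports Defs
begin

text \<open>
  In the eigenvector basis, the coordinates of \<open>f(s)\<close> and \<open>g(s)\<close> have removable singularities at
  the eigenvalues: as \<open>s\<close> tends to an eigenvalue \<open>d\<^sub>m\<close>, the \<open>m\<close>-th coordinate tends to a nonzero limit
  and all others are \<open>O(s - d\<^sub>m)\<close>. Put \<open>e = \<parallel>S - \<Lambda>\<parallel>\<close>. Then \<open>M = Y\<^sup>T X\<close> has diagonal bounded away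
  from \<open>0\<close> and off-diagonal entries \<open>O(e)\<close>, while \<open>G = Y\<^sup>T A X - M diag(\<Lambda>)\<close> has entries \<open>O(e)\<close> and
  diagonal entries \<open>O(e\<^sup>2)\<close>. As \<open>M (F - diag(\<Lambda>)) = G\<close>, diagonal dominance first gives
  \<open>F - diag(\<Lambda>) = O(e)\<close>, and then the \<open>l\<close>-th equation for the \<open>l\<close>-th column gives \<open>O(e\<^sup>2)\<close> on the
  diagonal, that is \<open>H(S) - \<Lambda> = O(e\<^sup>2)\<close>.
\<close>

section \<open>Matrix inverses and the bilinear product\<close>

lemma matrix_inv_inverse:
  fixes A :: "'a::semiring_1^'n^'m"
  assumes "invertible A"
  shows "A ** matrix_inv A = mat 1" "matrix_inv A ** A = mat 1"
  using someI_ex[of "\<lambda>B. A ** B = mat 1 \<and> B ** A = mat 1"] assms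
  unfolding matrix_inv_def invertible_def by auto

lemma matrix_inv_unique:
  fixes A :: "'a::semiring_1^'n^'m"
  assumes "A ** B = mat 1" "B ** A = mat 1"
  shows "matrix_inv A = B"
proof -
  have "invertible A" using assms by (auto simp: invertible_def)
  then have "matrix_inv A = matrix_inv A ** (A ** B)" using assms by simp
  also have "\<dots> = B" using \<open>invertible A\<close> by (simp add: matrix_mul_assoc matrix_inv_inverse)
  finally show ?thesis .
qed

lemma matrix_inv_vector_mult:
  fixes A :: "'a::semiring_1^'n^'m"
  assumes "invertible A" "A *v x = y"
  shows "matrix_inv A *v y = x"
  using assms by (auto simp: matrix_vector_mul_assoc matrix_inv_inverse)

lemma mat_vector_mult: "mat s *v x = s *s x"
  by (simp add: vec_eq_iff matrix_vector_mult_def mat_def if_distrib[of "\<lambda>t. t * _"] cong: if_cong)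

lemma matrix_vector_mult_axis: "(M *v axis l 1) $ k = M $ k $ l"
  by (simp add: matrix_vector_mult_def axis_def if_distrib[of "\<lambda>t. _ * t"] cong: if_cong)

lemma scalar_product_matrix_vector:
  fixes P :: "'a::comm_semiring_1^'n^'m"
  shows "scalar_product c (P *v x) = scalar_product (transpose P *v c) x"
  unfolding scalar_product_def matrix_vector_mult_def transpose_def
  by (simp add: sum_distrib_left sum_distrib_right mult_ac) (rule sum.swap)

lemma scalar_product_axis: "scalar_product x (axis j 1) = x $ j"
  by (simp add: scalar_product_def axis_def if_distrib[of "\<lambda>t. _ * t"] cong: if_cong)

lemma diagonal_vector_mult:
  assumes "diagonal D"
  shows "D *v x = (\<chi> j. D $ j $ j * x $ j)"
proof -
  have "(\<Sum>j\<in>UNIV. D $ i $ j * x $ j) = (\<Sum>j\<in>UNIV. if j = i then D $ i $ i * x $ i else 0)" for i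
    using assms by (intro sum.cong) (auto simp: diagonal_def)
  then show ?thesis
    by (simp add: vec_eq_iff matrix_vector_mult_def)
qed

section \<open>Spectrum and characteristic polynomial of a diagonalized matrix\<close>

text \<open>Stated on vectors \<open>P *v x\<close> so that the eigenvalue equation, the resolvent
  and the residual of the iteration can all be computed in eigenvector coordinates.\<close>

lemma diagonalized_shift_mult:
  fixes P :: "complex^'n^'n"
  assumes "invertible P"
  shows "(P ** D ** matrix_inv P - mat s) *v (P *v x) = P *v (D *v x - s *s x)"
proof -
  have "(P ** D ** matrix_inv P) *v (P *v x) = P *v (D *v x)"
    by (metis assms matrix_inv_inverse(2) matrix_vector_mul_assoc matrix_vector_mul_lid)
  then show ?thesis
    by (simp add: algebra_simps mat_vector_mult vector_scalar_commute)
qed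

lemma eigenvalues_diagonalized:
  fixes P :: "complex^'n^'n"
  assumes "invertible P" "diagonal D"
  shows "eigenvalues (P ** D ** matrix_inv P) = range (\<lambda>j. D $ j $ j)"
proof -
  let ?A = "P ** D ** matrix_inv P"
  \<comment> \<open>Injectivity of \<open>P\<close> removes the outer factor, and \<open>D\<close>
    decouples the coordinates.\<close>
  have shift: "?A *v (P *v x) = s *s (P *v x) \<longleftrightarrow> (\<forall>j. D $ j $ j * x $ j = s * x $ j)" for s x
  proof -
    have "?A *v (P *v x) = s *s (P *v x) \<longleftrightarrow> (?A - mat s) *v (P *v x) = 0"
      by (simp add: matrix_vector_mult_diff_rdistrib mat_vector_mult)
    also have "\<dots> \<longleftrightarrow> D *v x - s *s x = 0"
      unfolding diagonalized_shift_mult[OF assms(1)]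
      by (metis assms(1) matrix_inv_vector_mult matrix_vector_mult_0_right)
    finally show ?thesis
      by (simp add: diagonal_vector_mult[OF assms(2)] vec_eq_iff)
  qed
  show ?thesis
  proof (intro set_eqI iffI)
    fix s assume "s \<in> eigenvalues ?A"
    then obtain v where v: "v \<noteq> 0" "?A *v v = s *s v" by (auto simp: eigenvalues_def)
    define x where "x = matrix_inv P *v v"
    have Px: "v = P *v x"
      by (simp add: x_def matrix_vector_mul_assoc matrix_inv_inverse assms(1))
    then have "x \<noteq> 0" using v(1) by auto
    then obtain j where "x $ j \<noteq> 0" by (auto simp: vec_eq_iff)
    moreover have "D $ j $ j * x $ j = s * x $ j" using v(2) shift Px by blast
    ultimately show "s \<in> range (\<lambda>j. D $ j $ j)" by auto
  next
    fix s assume "s \<in> range (\<lambda>j. D $ j $ j)"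
    then obtain j where s: "s = D $ j $ j" by auto
    have "?A *v (P *v axis j 1) = s *s (P *v axis j 1)"
      by (subst shift) (auto simp: s axis_def)
    moreover have "P *v axis j 1 \<noteq> 0"
      by (metis assms(1) axis_eq_0_iff matrix_inv_vector_mult matrix_vector_mult_0_right zero_neq_one)
    ultimately show "s \<in> eigenvalues ?A" by (auto simp: eigenvalues_def)
  qed
qed

text \<open>Embedding constants into polynomials respects products, so a factorization of a complex
  matrix carries over to the polynomial ring where \<open>charpoly\<close> is formed.\<close>

lemma map_matrix_const_poly_mult:
  fixes A B :: "complex^'n^'n"
  shows "map_matrix (\<lambda>a. [:a:]) (A ** B) = map_matrix (\<lambda>a. [:a:]) A ** map_matrix (\<lambda>a. [:a:]) B"
proof -
  have "[:\<Sum>k\<in>K. f k:] = (\<Sum>k\<in>K. [:f k:])" for K and f :: "'n \<Rightarrow> complex"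
    by (rule poly_eqI) (simp add: coeff_sum coeff_pCons split: nat.split)
  then show ?thesis
    by (simp add: vec_eq_iff matrix_matrix_mult_def mult.commute)
qed

text \<open>The scalar matrix \<open>?x\<close> commutes with everything, so \<open>x I - A\<close>
  is conjugate to \<open>x I - D\<close> over the polynomial ring, and the determinant is
  multiplicative there.\<close>

lemma charpoly_diagonalized:
  fixes P :: "complex^'n^'n"
  assumes "invertible P" "diagonal D"
  shows "charpoly (P ** D ** matrix_inv P) = (\<Prod>j\<in>UNIV. [:- (D $ j $ j), 1:])"
proof -
  let ?C = "map_matrix (\<lambda>a. [:a:]) :: complex^'n^'n \<Rightarrow> complex poly^'n^'n"
  let ?x = "mat [:0, 1:] :: complex poly^'n^'n"
  have one: "?C (mat 1) = mat 1"
    by (simp add: vec_eq_iff mat_def)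
  have inv: "?C P ** ?C (matrix_inv P) = mat 1"
    using assms(1) by (simp flip: map_matrix_const_poly_mult add: matrix_inv_inverse one)
  have x: "?x ** B = B ** ?x" for B :: "complex poly^'n^'n"
    by (simp add: vec_eq_iff matrix_matrix_mult_def mat_def
      if_distrib[of "\<lambda>t. t * _"] if_distrib[of "\<lambda>t. _ * t"] mult.commute cong: if_cong)
  have ring: "B ** (E - F) = B ** E - B ** F" "(E - F) ** B = E ** B - F ** B"
    for B E F :: "complex poly^'n^'n"
    by (simp_all add: vec_eq_iff matrix_matrix_mult_def algebra_simps sum_subtractf)
  have "?C P ** (?x - ?C D) ** ?C (matrix_inv P)
      = ?x ** (?C P ** ?C (matrix_inv P)) - ?C (P ** D ** matrix_inv P)"
    by (simp add: ring map_matrix_const_poly_mult flip: x) (simp add: matrix_mul_assoc x)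
  then have eq: "?C P ** (?x - ?C D) ** ?C (matrix_inv P) = ?x - ?C (P ** D ** matrix_inv P)"
    by (simp add: inv)
  have "charpoly (P ** D ** matrix_inv P) = det (?C P ** (?x - ?C D) ** ?C (matrix_inv P))"
    unfolding charpoly_def eq ..
  also have "\<dots> = det (?x - ?C D) * det (?C P ** ?C (matrix_inv P))"
    by (simp add: det_mul)
  also have "\<dots> = det (?x - ?C D)"
    by (simp add: inv)
  also have "\<dots> = (\<Prod>j\<in>UNIV. (?x - ?C D) $ j $ j)"
    using assms(2) by (intro det_diagonal) (auto simp: mat_def diagonal_def)
  finally show ?thesis by (simp add: mat_def)
qed

text \<open>A repeated diagonal entry would put the square of a linear factor into the
  characteristic polynomial. Injectivity makes the index chosen by \<open>THE\<close> in
  \<open>ddpse_f\<close> and \<open>ddpse_g\<close> unique.\<close>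

lemma simple_eigenvalues_inj_diagonal:
  fixes P :: "complex^'n^'n"
  assumes "invertible P" "diagonal D"
    and "\<forall>s \<in> eigenvalues (P ** D ** matrix_inv P). simple_eigenvalue (P ** D ** matrix_inv P) s"
  shows "inj (\<lambda>j. D $ j $ j)"
proof (rule injI, rule ccontr)
  fix i j assume ij: "D $ i $ i = D $ j $ j" "i \<noteq> j"
  let ?s = "D $ i $ i" and ?q = "\<lambda>k. [:- (D $ k $ k), 1:]"
  let ?p = "charpoly (P ** D ** matrix_inv P)"
  have "prod ?q {i, j} dvd ?p"
    unfolding charpoly_diagonalized[OF assms(1,2)] by (rule prod_dvd_prod_subset) auto
  moreover have "prod ?q {i, j} = [:- ?s, 1:] ^ 2"
    unfolding power2_eq_square using ij by (subst prod.insert) auto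
  ultimately have "[:- ?s, 1:] ^ 2 dvd ?p" by simp
  moreover have "?p \<noteq> 0"
    by (simp add: charpoly_diagonalized[OF assms(1,2)])
  ultimately have "2 \<le> order ?s ?p" by (simp add: order_divides)
  moreover have "order ?s ?p = 1"
    using assms(3) by (auto simp: simple_eigenvalue_def eigenvalues_diagonalized[OF assms(1,2)])
  ultimately show False by simp
qed

section \<open>Eigenvector coordinates of \<open>f\<close> and \<open>g\<close>\<close>

text \<open>The coordinates of \<open>f(s)\<close> in the eigenvector basis \<open>P\<close>, where \<open>\<beta> = P\<^sup>-\<^sup>1 b\<close>,
  \<open>\<gamma> = P\<^sup>T c\<close> and \<open>d\<close> is the diagonal of \<open>D\<close>. Exchanging \<open>\<beta>\<close> and \<open>\<gamma>\<close> gives the coordinates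
  of \<open>g(s)\<close> in the dual basis \<open>P\<^sup>-\<^sup>T\<close>.\<close>
definition modal_coords ::
  "complex^'n \<Rightarrow> complex^'n \<Rightarrow> ('n \<Rightarrow> complex) \<Rightarrow> complex \<Rightarrow> complex^'n" where
  "modal_coords \<beta> \<gamma> d s =
    (if s \<in> range d then axis (THE j. d j = s) (1 / \<gamma> $ (THE j. d j = s))
     else (\<chi> j. \<beta> $ j / (d j - s) / (\<Sum>i\<in>UNIV. \<gamma> $ i * \<beta> $ i / (d i - s))))"

text \<open>Off the spectrum the shifted matrix has trivial kernel, hence is invertible, so it
  suffices to check that it maps the proposed vector to \<open>b\<close>.\<close>

lemma resolvent_diagonalized:
  fixes P :: "complex^'n^'n"
  assumes "invertible P" "diagonal D" "s \<notin> range (\<lambda>j. D $ j $ j)"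
  shows "matrix_inv (P ** D ** matrix_inv P - mat s) *v b
    = P *v (\<chi> j. (matrix_inv P *v b) $ j / (D $ j $ j - s))"
proof (rule matrix_inv_vector_mult)
  let ?A = "P ** D ** matrix_inv P"
  have "s \<notin> eigenvalues ?A" using assms by (simp add: eigenvalues_diagonalized)
  then show "invertible (?A - mat s)"
    unfolding invertible_left_inverse matrix_left_invertible_ker
    by (auto simp: eigenvalues_def matrix_vector_mult_diff_rdistrib mat_vector_mult)
  have shift: "D $ j $ j * (y / (D $ j $ j - s)) - s * (y / (D $ j $ j - s)) = y" for j y
    using assms(3) by (subst left_diff_distrib[symmetric]) auto
  have "D *v (\<chi> j. (matrix_inv P *v b) $ j / (D $ j $ j - s))
      - s *s (\<chi> j. (matrix_inv P *v b) $ j / (D $ j $ j - s)) = matrix_inv P *v b"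
    unfolding diagonal_vector_mult[OF assms(2)] vec_eq_iff
    by (simp add: shift del: times_divide_eq_right)
  then show "(?A - mat s) *v (P *v (\<chi> j. (matrix_inv P *v b) $ j / (D $ j $ j - s))) = b"
    unfolding diagonalized_shift_mult[OF assms(1)]
    by (simp add: matrix_vector_mul_assoc matrix_inv_inverse assms(1))
qed

lemma transfer_fun_diagonalized:
  fixes P :: "complex^'n^'n"
  assumes "invertible P" "diagonal D" "s \<notin> range (\<lambda>j. D $ j $ j)"
  shows "transfer_fun (P ** D ** matrix_inv P) b c s
    = (\<Sum>j\<in>UNIV. (transpose P *v c) $ j * (matrix_inv P *v b) $ j / (D $ j $ j - s))"
  unfolding transfer_fun_def resolvent_diagonalized[OF assms] scalar_product_matrix_vector
  by (simp add: scalar_product_def)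

text \<open>At an eigenvalue the normalizing factor \<open>c^T P e_j\<close> is the
  \<open>j\<close>-th entry of \<open>transpose P *v c\<close>; elsewhere the resolvent and the
  transfer function are both explicit in coordinates.\<close>

lemma ddpse_f_modal:
  fixes P :: "complex^'n^'n"
  assumes "invertible P" "diagonal D"
  shows "ddpse_f (P ** D ** matrix_inv P) P D b c s
    = P *v modal_coords (matrix_inv P *v b) (transpose P *v c) (\<lambda>j. D $ j $ j) s"
proof (cases "s \<in> range (\<lambda>j. D $ j $ j)")
  case True
  have "axis j (1 / x) = (1 / x) *s axis j 1" for j :: 'n and x :: complex
    by (simp add: vec_eq_iff axis_def)
  with True show ?thesis
    by (simp add: ddpse_f_def modal_coords_def eigenvalues_diagonalized[OF assms] Let_def
      scalar_product_matrix_vector scalar_product_axis flip: vector_scalar_commute)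
next
  case False
  then show ?thesis
    unfolding ddpse_f_def transfer_fun_diagonalized[OF assms False] resolvent_diagonalized[OF assms False]
      eigenvalues_diagonalized[OF assms]
    by (simp add: modal_coords_def flip: vector_scalar_commute)
      (rule arg_cong[where f="\<lambda>x. P *v x"], simp add: vec_eq_iff)
qed

text \<open>The transposed matrix is diagonalized by \<open>Q\<close> with the same
  \<open>D\<close>, so results about \<open>f\<close> apply to \<open>g\<close> after exchanging
  \<open>b\<close> and \<open>c\<close>.\<close>

lemma transpose_diagonalized:
  fixes P :: "complex^'n^'n"
  assumes "invertible P" "diagonal D"
  defines "Q \<equiv> transpose (matrix_inv P)"
  shows "invertible Q" "matrix_inv Q = transpose P"
    "transpose (P ** D ** matrix_inv P) = Q ** D ** matrix_inv Q"
proof -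
  have inv: "Q ** transpose P = mat 1" "transpose P ** Q = mat 1"
    unfolding Q_def by (simp_all flip: matrix_transpose_mul add: matrix_inv_inverse assms(1) transpose_mat)
  then show "invertible Q" and Q: "matrix_inv Q = transpose P"
    by (auto simp: invertible_def intro: matrix_inv_unique)
  have "transpose D = D"
    using assms(2) by (auto simp: diagonal_def transpose_def vec_eq_iff) metis
  then show "transpose (P ** D ** matrix_inv P) = Q ** D ** matrix_inv Q"
    unfolding Q by (simp add: matrix_transpose_mul matrix_mul_assoc Q_def)
qed

lemma ddpse_g_modal:
  fixes P :: "complex^'n^'n"
  assumes "invertible P" "diagonal D"
  shows "ddpse_g (P ** D ** matrix_inv P) P D b c s
    = transpose (matrix_inv P) *v
        modal_coords (transpose P *v c) (matrix_inv P *v b) (\<lambda>j. D $ j $ j) s"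
proof -
  let ?A = "P ** D ** matrix_inv P" and ?Q = "transpose (matrix_inv P)"
  note T = transpose_diagonalized[OF assms]
  have eig: "eigenvalues (transpose ?A) = eigenvalues ?A"
    using eigenvalues_diagonalized[OF T(1) assms(2)] eigenvalues_diagonalized[OF assms] T(3) by simp
  \<comment> \<open>Transposing the matrix and exchanging the two vectors leaves the transfer
    function unchanged, so \<open>g\<close> has the normalization that \<open>f\<close> has for the
    transposed data.\<close>
  have "transfer_fun (transpose ?A) c b s = transfer_fun ?A b c s" if "s \<notin> eigenvalues ?A"
    using that transfer_fun_diagonalized[OF assms, of s b c]
      transfer_fun_diagonalized[OF T(1) assms(2), of s c b] T(2,3)
    by (simp add: eigenvalues_diagonalized[OF assms] mult.commute)
  then have "ddpse_g ?A P D b c s = ddpse_f (transpose ?A) ?Q D c b s"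
    by (simp add: ddpse_g_def ddpse_f_def eig)
  also have "\<dots> = ?Q *v modal_coords (transpose P *v c) (matrix_inv P *v b) (\<lambda>j. D $ j $ j) s"
    using ddpse_f_modal[OF T(1) assms(2), of c b s] T(2,3) by simp
  finally show ?thesis .
qed

section \<open>Behaviour of the coordinates near an eigenvalue\<close>

lemma modal_coords_at:
  assumes "inj d"
  shows "modal_coords \<beta> \<gamma> d (d m) = axis m (1 / \<gamma> $ m)"
  using assms by (auto simp: modal_coords_def inj_eq the_equality)

text \<open>Multiplying numerator and denominator by \<open>d m - s\<close> removes the singularity at \<open>d m\<close>.\<close>
lemma modal_coords_near:
  fixes d :: "'n::finite \<Rightarrow> complex"
  assumes "inj d" "\<beta> $ m \<noteq> 0" "\<forall>j. j \<noteq> m \<longrightarrow> s \<noteq> d j"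
  shows "modal_coords \<beta> \<gamma> d s $ j
    = \<beta> $ j * (if j = m then 1 else (d m - s) / (d j - s))
      / (\<gamma> $ m * \<beta> $ m + (\<Sum>i\<in>UNIV - {m}. \<gamma> $ i * \<beta> $ i * (d m - s) / (d i - s)))"
proof (cases "s = d m")
  case True
  then show ?thesis
    using assms by (simp add: modal_coords_at axis_def)
next
  case False
  then have nz: "d m - s \<noteq> 0" and "s \<notin> range d" using assms(3) by auto
  let ?h = "\<Sum>i\<in>UNIV. \<gamma> $ i * \<beta> $ i / (d i - s)"
  have h: "\<gamma> $ m * \<beta> $ m + (\<Sum>i\<in>UNIV - {m}. \<gamma> $ i * \<beta> $ i * (d m - s) / (d i - s)) = (d m - s) * ?h"
    using nz by (simp add: sum.remove[of UNIV m] distrib_left sum_distrib_left mult_ac)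
  show ?thesis
    unfolding h using nz \<open>s \<notin> range d\<close> by (simp add: modal_coords_def)
qed

lemma eventually_modal_coords_near:
  fixes d :: "'n::finite \<Rightarrow> complex"
  assumes "inj d"
  shows "\<forall>\<^sub>F s in nhds (d m). \<forall>j. j \<noteq> m \<longrightarrow> s \<noteq> d j"
proof -
  have "open (- d ` (UNIV - {m}))" by (intro open_Compl finite_imp_closed) simp
  moreover have "d m \<in> - d ` (UNIV - {m})" using assms by (auto dest: injD)
  ultimately have "\<forall>\<^sub>F s in nhds (d m). s \<in> - d ` (UNIV - {m})" by (rule eventually_nhds_in_open)
  then show ?thesis by eventually_elim auto
qed

text \<open>Each summand keeps the factor \<open>d m - s\<close>, while \<open>d i - s\<close> tends
  to \<open>d i - d m\<close>, which is nonzero by injectivity.\<close>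

lemma modal_denominator_tendsto:
  fixes d :: "'n::finite \<Rightarrow> complex"
  assumes "inj d"
  shows "((\<lambda>s. \<gamma> $ m * \<beta> $ m + (\<Sum>i\<in>UNIV - {m}. \<gamma> $ i * \<beta> $ i * (d m - s) / (d i - s)))
    \<longlongrightarrow> \<gamma> $ m * \<beta> $ m) (nhds (d m))"
proof -
  have "((\<lambda>s. \<gamma> $ m * \<beta> $ m + (\<Sum>i\<in>UNIV - {m}. \<gamma> $ i * \<beta> $ i * (d m - s) / (d i - s)))
    \<longlongrightarrow> \<gamma> $ m * \<beta> $ m + (\<Sum>i\<in>UNIV - {m}. \<gamma> $ i * \<beta> $ i * (d m - d m) / (d i - d m))) (nhds (d m))"
    using assms by (intro tendsto_intros filterlim_ident) (auto dest: injD)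
  then show ?thesis by simp
qed

text \<open>The full neighborhood filter includes \<open>s = d m\<close>, since a component of an
  iterate may hit an eigenvalue exactly; the formula of \<open>modal_coords_near\<close> covers that
  point too.\<close>

lemma modal_coords_tendsto:
  fixes d :: "'n::finite \<Rightarrow> complex"
  assumes "inj d" "\<beta> $ m \<noteq> 0" "\<gamma> $ m \<noteq> 0"
  shows "((\<lambda>s. modal_coords \<beta> \<gamma> d s $ m) \<longlongrightarrow> 1 / \<gamma> $ m) (nhds (d m))"
proof -
  have "((\<lambda>s. \<beta> $ m / (\<gamma> $ m * \<beta> $ m + (\<Sum>i\<in>UNIV - {m}. \<gamma> $ i * \<beta> $ i * (d m - s) / (d i - s))))
      \<longlongrightarrow> \<beta> $ m / (\<gamma> $ m * \<beta> $ m)) (nhds (d m))"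
    using assms(2,3) by (intro tendsto_divide tendsto_const modal_denominator_tendsto assms(1)) simp
  then have "((\<lambda>s. modal_coords \<beta> \<gamma> d s $ m) \<longlongrightarrow> \<beta> $ m / (\<gamma> $ m * \<beta> $ m)) (nhds (d m))"
    by (rule Lim_transform_eventually)
      (rule eventually_mono[OF eventually_modal_coords_near[OF assms(1)]],
        simp add: modal_coords_near[OF assms(1,2)])
  then show ?thesis using assms(2) by simp
qed

text \<open>For \<open>j\<close> other than \<open>m\<close> the factor \<open>d m - s\<close>
  survives in the numerator; the remaining quotient \<open>q\<close> has a finite limit and so is
  bounded near \<open>d m\<close>.\<close>

lemma modal_coords_off:
  fixes d :: "'n::finite \<Rightarrow> complex"
  assumes "inj d" "\<beta> $ m \<noteq> 0" "\<gamma> $ m \<noteq> 0" "j \<noteq> m"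
  shows "\<exists>C. \<forall>\<^sub>F s in nhds (d m). norm (modal_coords \<beta> \<gamma> d s $ j) \<le> C * norm (s - d m)"
proof -
  define q where "q s = \<beta> $ j / (d j - s)
    / (\<gamma> $ m * \<beta> $ m + (\<Sum>i\<in>UNIV - {m}. \<gamma> $ i * \<beta> $ i * (d m - s) / (d i - s)))" for s
  define L where "L = \<beta> $ j / (d j - d m) / (\<gamma> $ m * \<beta> $ m)"
  have "(q \<longlongrightarrow> L) (nhds (d m))"
    unfolding q_def L_def using assms
    by (intro tendsto_divide tendsto_diff tendsto_const modal_denominator_tendsto filterlim_ident)
      (auto dest: injD)
  then have "((\<lambda>s. norm (q s)) \<longlongrightarrow> norm L) (nhds (d m))" by (rule tendsto_norm)
  then have "\<forall>\<^sub>F s in nhds (d m). norm (q s) < norm L + 1"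
    by (rule order_tendstoD) simp
  then have "\<forall>\<^sub>F s in nhds (d m). norm (modal_coords \<beta> \<gamma> d s $ j) \<le> (norm L + 1) * norm (s - d m)"
    using eventually_modal_coords_near[OF assms(1)]
  proof eventually_elim
    case (elim s)
    have "modal_coords \<beta> \<gamma> d s $ j = q s * (d m - s)"
      using elim(2) assms(4) by (simp add: modal_coords_near[OF assms(1,2)] q_def)
    then show ?case
      using elim(1) by (simp add: norm_mult norm_minus_commute mult_right_mono)
  qed
  then show ?thesis ..
qed

section \<open>Diagonally dominant linear systems\<close>

text \<open>The crude bound \<open>\<eta>\<close> on all rows controls the sum of the norms of the
  entries of \<open>x\<close>; inserting this into row \<open>l\<close> alone keeps that row's own,
  possibly much smaller, right-hand side.\<close>

lemma diagonally_dominant_bound: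
  fixes M :: "complex^'p^'p" and \<mu> \<epsilon> \<eta> :: real
  assumes "\<mu> > 0" "\<epsilon> \<ge> 0" "2 * real CARD('p) * \<epsilon> \<le> \<mu>"
    and diag: "\<And>k. \<mu> \<le> norm (M $ k $ k)"
    and off: "\<And>k i. i \<noteq> k \<Longrightarrow> norm (M $ k $ i) \<le> \<epsilon>"
    and rhs: "\<And>k. norm ((M *v x) $ k) \<le> \<eta>"
  shows "\<mu> * norm (x $ l) \<le> norm ((M *v x) $ l) + \<epsilon> * (2 * real CARD('p) * \<eta> / \<mu>)"
proof -
  define a where "a = (\<Sum>i\<in>UNIV. norm (x $ i))"
  have row: "\<mu> * norm (x $ k) \<le> norm ((M *v x) $ k) + \<epsilon> * a" for k
  proof -
    have "M $ k $ k * x $ k = (M *v x) $ k - (\<Sum>i\<in>UNIV - {k}. M $ k $ i * x $ i)"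
      by (simp add: matrix_vector_mult_def sum.remove[of UNIV k])
    then have "norm (M $ k $ k) * norm (x $ k) \<le> norm ((M *v x) $ k) + norm (\<Sum>i\<in>UNIV - {k}. M $ k $ i * x $ i)"
      by (metis norm_mult norm_triangle_ineq4)
    also have "norm (\<Sum>i\<in>UNIV - {k}. M $ k $ i * x $ i) \<le> (\<Sum>i\<in>UNIV - {k}. \<epsilon> * norm (x $ i))"
      by (intro sum_norm_le) (auto simp: norm_mult intro!: mult_right_mono off)
    also have "\<dots> \<le> (\<Sum>i\<in>UNIV. \<epsilon> * norm (x $ i))"
      using assms(2) by (intro sum_mono2) auto
    finally have "norm (M $ k $ k) * norm (x $ k) \<le> norm ((M *v x) $ k) + \<epsilon> * a"
      by (simp add: a_def sum_distrib_left)
    moreover have "\<mu> * norm (x $ k) \<le> norm (M $ k $ k) * norm (x $ k)"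
      by (intro mult_right_mono diag) simp
    ultimately show ?thesis by linarith
  qed
  have "a \<ge> 0" unfolding a_def by (intro sum_nonneg) simp
  \<comment> \<open>Summing the row inequalities leaves a term
    \<open>CARD('p) * \<epsilon> * a\<close>, which is at most half of \<open>\<mu> * a\<close> and
    is absorbed on the left.\<close>
  have "\<mu> * a = (\<Sum>k\<in>UNIV. \<mu> * norm (x $ k))" by (simp add: a_def sum_distrib_left)
  also have "\<dots> \<le> (\<Sum>k\<in>(UNIV::'p set). \<eta> + \<epsilon> * a)"
    by (intro sum_mono order_trans[OF row] add_right_mono rhs)
  finally have "2 * (\<mu> * a) \<le> 2 * real CARD('p) * \<eta> + (2 * real CARD('p) * \<epsilon>) * a"
    by (simp add: algebra_simps)
  also have "\<dots> \<le> 2 * real CARD('p) * \<eta> + \<mu> * a"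
    using assms(3) \<open>a \<ge> 0\<close> by (intro add_left_mono mult_right_mono) auto
  finally have "a \<le> 2 * real CARD('p) * \<eta> / \<mu>"
    using assms(1) by (simp add: field_simps)
  then have "\<epsilon> * a \<le> \<epsilon> * (2 * real CARD('p) * \<eta> / \<mu>)"
    using assms(2) by (rule mult_left_mono)
  with row[of l] show ?thesis by linarith
qed

text \<open>With \<open>\<eta> = 0\<close> the preceding bound shows that the kernel is
  trivial.\<close>

lemma diagonally_dominant_invertible:
  fixes M :: "complex^'p^'p" and \<mu> \<epsilon> :: real
  assumes "\<mu> > 0" "\<epsilon> \<ge> 0" "2 * real CARD('p) * \<epsilon> \<le> \<mu>"
    and "\<And>k. \<mu> \<le> norm (M $ k $ k)"
    and "\<And>k i. i \<noteq> k \<Longrightarrow> norm (M $ k $ i) \<le> \<epsilon>"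
  shows "invertible M"
proof -
  have "x = 0" if "M *v x = 0" for x
  proof -
    have "\<mu> * norm (x $ l) \<le> 0" for l
      using diagonally_dominant_bound[OF assms, where x=x and \<eta>=0 and l=l] that by simp
    then show ?thesis using assms(1) by (auto simp: vec_eq_iff mult_le_0_iff)
  qed
  then show ?thesis
    unfolding invertible_left_inverse matrix_left_invertible_ker by blast
qed

section \<open>From a local quadratic estimate to convergence\<close>

text \<open>On a ball small enough that \<open>\<bar>C\<bar>\<close> times the radius is at most
  \<open>1 / 2\<close>, each step halves the error, so iterates stay in the ball and the estimate
  applies at every step.\<close>

lemma quadratic_contraction_converges:
  fixes H :: "'a::real_normed_vector \<Rightarrow> 'a"
  assumes "\<forall>\<^sub>F x in nhds l. x \<in> U \<and> norm (H x - l) \<le> C * (norm (x - l))\<^sup>2"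
  shows "\<exists>V. open V \<and> l \<in> V \<and> (\<forall>x\<in>V. iteration_converges_quadratically U H x l)"
proof -
  obtain \<delta> where \<delta>: "\<delta> > 0"
    "\<And>x. dist x l < \<delta> \<Longrightarrow> x \<in> U \<and> norm (H x - l) \<le> C * (norm (x - l))\<^sup>2"
    using assms unfolding eventually_nhds_metric by blast
  \<comment> \<open>The added 2 keeps \<open>q\<close> positive when \<open>C = 0\<close>;
    \<open>C\<close> may also be negative.\<close>
  define q where "q = 2 * \<bar>C\<bar> + 2"
  have "q > 0" unfolding q_def by linarith
  define r where "r = min \<delta> (1 / q)"
  have r: "r > 0" "r \<le> \<delta>" "\<bar>C\<bar> * r \<le> 1 / 2"
  proof -
    show "r > 0" "r \<le> \<delta>" using \<delta>(1) \<open>q > 0\<close> by (simp_all add: r_def)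
    have "\<bar>C\<bar> \<le> q / 2" "r \<le> 1 / q" by (simp_all add: q_def r_def)
    then have "\<bar>C\<bar> * r \<le> q / 2 * (1 / q)"
      using \<open>r > 0\<close> \<open>q > 0\<close> by (intro mult_mono) simp_all
    then show "\<bar>C\<bar> * r \<le> 1 / 2" using \<open>q > 0\<close> by simp
  qed
  have "iteration_converges_quadratically U H x l" if "x \<in> ball l r" for x
  proof -
    have step: "norm (H y - l) \<le> norm (y - l) / 2" if "norm (y - l) < r" for y
    proof -
      have "norm (H y - l) \<le> C * (norm (y - l))\<^sup>2"
        using that r(2) by (intro \<delta>(2)[THEN conjunct2]) (simp add: dist_norm)
      also have "\<dots> \<le> \<bar>C\<bar> * norm (y - l) * norm (y - l)"
        unfolding power2_eq_square mult.assoc by (intro mult_right_mono) simp_all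
      also have "\<dots> \<le> \<bar>C\<bar> * r * norm (y - l)"
        using that by (intro mult_right_mono mult_left_mono) auto
      also have "\<dots> \<le> 1 / 2 * norm (y - l)" using r by (intro mult_right_mono) auto
      finally show ?thesis by simp
    qed
    have iter: "norm ((H ^^ k) x - l) < r \<and> norm ((H ^^ k) x - l) \<le> r * (1 / 2) ^ k" for k
    proof (induction k)
      case 0
      then show ?case using that by (simp add: dist_norm norm_minus_commute less_imp_le)
    next
      case (Suc k)
      have "norm ((H ^^ Suc k) x - l) \<le> norm ((H ^^ k) x - l) / 2"
        using step[of "(H ^^ k) x"] Suc by simp
      moreover have "r * (1 / 2) ^ Suc k = r * (1 / 2) ^ k / 2" by simp
      ultimately show ?case using Suc norm_ge_zero[of "(H ^^ k) x - l"] by linarith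
    qed
    have "(\<lambda>k. r * (1 / 2) ^ k) \<longlonglongrightarrow> r * 0"
      by (intro tendsto_intros LIMSEQ_power_zero) simp
    then have "(\<lambda>k. r * (1 / 2) ^ k) \<longlonglongrightarrow> 0" by simp
    moreover have "\<forall>\<^sub>F k in sequentially. norm ((H ^^ k) x - l) \<le> r * (1 / 2) ^ k"
      using iter by (intro always_eventually) blast
    ultimately have "(\<lambda>k. (H ^^ k) x - l) \<longlonglongrightarrow> 0"
      by (rule Lim_null_comparison[rotated])
    then have "(\<lambda>k. (H ^^ k) x) \<longlonglongrightarrow> l" by (simp add: LIM_zero_iff)
    moreover have "(H ^^ k) x \<in> U \<and> norm ((H ^^ Suc k) x - l) \<le> C * (norm ((H ^^ k) x - l))\<^sup>2" for k
    proof -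
      have "dist ((H ^^ k) x) l < \<delta>" using iter[of k] r(2) unfolding dist_norm by linarith
      from \<delta>(2)[OF this] show ?thesis by simp
    qed
    ultimately show ?thesis unfolding iteration_converges_quadratically_def by blast
  qed
  then show ?thesis using r(1) by (intro exI[of _ "ball l r"]) auto
qed

section \<open>The residual equation and its uniform estimates\<close>

lemma scalar_product_norm_le:
  fixes w u :: "complex^'n"
  assumes "\<And>j. norm (w $ j * u $ j) \<le> B"
  shows "norm (scalar_product w u) \<le> real CARD('n) * B"
  unfolding scalar_product_def using sum_norm_bound[of UNIV "\<lambda>j. w $ j * u $ j" B] assms by simp

text \<open>\<open>x\<close> is the \<open>l\<close>-th column of \<open>F(S) - z I\<close>, so that \<open>(Y\<^sup>T X) x\<close> is the \<open>l\<close>-th column of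
  \<open>Y\<^sup>T (A - z I) X\<close>; this avoids inverting \<open>Y\<^sup>T X\<close>.\<close>
lemma ddpse_H_residual:
  fixes S :: "complex^'p" and A :: "complex^'n^'n"
  assumes "S \<in> ddpse_domain A P D b c"
  defines "f \<equiv> ddpse_f A P D b c" and "g \<equiv> ddpse_g A P D b c"
  obtains x where "x $ l = ddpse_H A P D b c S $ l - z"
    and "\<And>k. ((\<chi> i j. scalar_product (g (S $ i)) (f (S $ j))) *v x) $ k
      = scalar_product (g (S $ k)) (A *v f (S $ l) - z *s f (S $ l))"
proof -
  let ?X = "ddpse_X A P D b c S" and ?Y = "ddpse_Y A P D b c S" and ?F = "ddpse_F A P D b c S"
  define x where "x = ?F *v axis l 1 - z *s axis l 1"
  have M: "(\<chi> i j. scalar_product (g (S $ i)) (f (S $ j))) = transpose ?Y ** ?X"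
    by (simp add: vec_eq_iff scalar_product_def matrix_matrix_mult_def transpose_def
      ddpse_X_def ddpse_Y_def f_def g_def)
  have Xl: "?X *v axis l 1 = f (S $ l)"
    by (simp add: vec_eq_iff ddpse_X_def f_def matrix_vector_mult_axis)
  have Y: "(transpose ?Y *v y) $ k = scalar_product (g (S $ k)) y" for y k
    by (simp add: matrix_vector_mult_def scalar_product_def transpose_def ddpse_Y_def g_def)
  have "(transpose ?Y ** ?X) ** ?F = transpose ?Y ** A ** ?X"
    using assms(1) by (simp add: ddpse_domain_def ddpse_F_def matrix_inv_inverse matrix_mul_assoc)
  then have "(transpose ?Y ** ?X) *v x = transpose ?Y *v (A *v f (S $ l) - z *s f (S $ l))"
    unfolding x_def matrix_vector_mult_diff_distrib vector_scalar_commute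
    by (simp add: matrix_vector_mul_assoc flip: Xl) (simp add: Xl flip: matrix_vector_mul_assoc)
  then have "((\<chi> i j. scalar_product (g (S $ i)) (f (S $ j))) *v x) $ k
      = scalar_product (g (S $ k)) (A *v f (S $ l) - z *s f (S $ l))" for k
    unfolding M by (simp only: Y)
  moreover have "x $ l = ddpse_H A P D b c S $ l - z"
    by (simp add: x_def ddpse_H_def matrix_vector_mult_axis)
  ultimately show ?thesis using that by blast
qed

text \<open>Finitely many bounds, each with its own constant, are merged by enlarging the constant,
  which monotonicity permits.\<close>

lemma eventually_uniform_bound:
  fixes P :: "'i \<Rightarrow> real \<Rightarrow> 'a \<Rightarrow> bool"
  assumes "finite I"
    and ex: "\<And>i. i \<in> I \<Longrightarrow> \<exists>C. \<forall>\<^sub>F x in F. P i C x"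
    and mono: "\<And>i x C C'. P i C x \<Longrightarrow> C \<le> C' \<Longrightarrow> P i C' x"
  shows "\<exists>C\<ge>1. \<forall>\<^sub>F x in F. \<forall>i\<in>I. P i C x"
proof -
  obtain c where c: "\<And>i. i \<in> I \<Longrightarrow> \<forall>\<^sub>F x in F. P i (c i) x" using ex by metis
  define C where "C = 1 + (\<Sum>i\<in>I. \<bar>c i\<bar>)"
  have le: "c i \<le> C" if "i \<in> I" for i
    using member_le_sum[of i I "\<lambda>i. \<bar>c i\<bar>"] that \<open>finite I\<close> by (simp add: C_def)
  have "\<forall>\<^sub>F x in F. \<forall>i\<in>I. P i C x"
    using c le by (intro eventually_ball_finite \<open>finite I\<close>) (blast intro: eventually_mono mono)
  moreover have "C \<ge> 1" by (simp add: C_def sum_nonneg)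
  ultimately show ?thesis by blast
qed

text \<open>One constant serves as upper bound and as reciprocal lower bound, so each condition is
  preserved when the constant grows, as the merging of bounds requires.\<close>

lemma modal_coords_bounds:
  fixes d :: "'n::finite \<Rightarrow> complex"
  assumes "inj d" "\<beta> $ m \<noteq> 0" "\<gamma> $ m \<noteq> 0"
  shows "\<exists>C. \<forall>\<^sub>F s in nhds (d m).
    if j = m then norm (modal_coords \<beta> \<gamma> d s $ j) \<le> C \<and> 1 \<le> C * norm (modal_coords \<beta> \<gamma> d s $ j)
    else norm (modal_coords \<beta> \<gamma> d s $ j) \<le> C * norm (s - d m)"
proof (cases "j = m")
  case True
  define L where "L = norm (1 / \<gamma> $ m)"
  have "L > 0" using assms(3) by (simp add: L_def)
  have lim: "((\<lambda>s. norm (modal_coords \<beta> \<gamma> d s $ m)) \<longlongrightarrow> L) (nhds (d m))"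
    unfolding L_def by (intro tendsto_norm modal_coords_tendsto assms)
  have "\<forall>\<^sub>F s in nhds (d m). norm (modal_coords \<beta> \<gamma> d s $ m) < L + 1"
    using order_tendstoD(2)[OF lim] by simp
  moreover have "\<forall>\<^sub>F s in nhds (d m). L / 2 < norm (modal_coords \<beta> \<gamma> d s $ m)"
    by (rule order_tendstoD(1)[OF lim]) (use \<open>L > 0\<close> in simp)
  ultimately have "\<forall>\<^sub>F s in nhds (d m). norm (modal_coords \<beta> \<gamma> d s $ m) \<le> max (L + 1) (2 / L) \<and>
      1 \<le> max (L + 1) (2 / L) * norm (modal_coords \<beta> \<gamma> d s $ m)"
  proof eventually_elim
    case (elim s)
    have "1 = 2 / L * (L / 2)" using \<open>L > 0\<close> by simp
    also have "\<dots> \<le> max (L + 1) (2 / L) * norm (modal_coords \<beta> \<gamma> d s $ m)"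
      using elim \<open>L > 0\<close> by (intro mult_mono) auto
    finally show ?case using elim by auto
  qed
  then show ?thesis using True by auto
next
  case False
  then show ?thesis using modal_coords_off[OF assms] by simp
qed

text \<open>The factor \<open>d j - d (\<sigma> l)\<close> cancels the only coordinate of \<open>u l\<close> that is not of size \<open>e\<close>. In
  row \<open>l\<close> the remaining coordinates of \<open>w l\<close> are of size \<open>e\<close> as well, which gives the second order.\<close>
lemma modal_residual_bound:
  fixes u w :: "'p::finite \<Rightarrow> complex^'n" and d :: "'n \<Rightarrow> complex" and \<sigma> :: "'p \<Rightarrow> 'n" and K e R :: real
  assumes "inj \<sigma>" "K \<ge> 1" "0 \<le> e" "e \<le> 1"
    and small: "4 * real CARD('p) * real CARD('n) * K ^ 4 * e \<le> 1"
    and u: "\<And>k. norm (u k $ \<sigma> k) \<le> K" "\<And>k. 1 \<le> K * norm (u k $ \<sigma> k)"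
      "\<And>k j. j \<noteq> \<sigma> k \<Longrightarrow> norm (u k $ j) \<le> K * e"
    and w: "\<And>k. norm (w k $ \<sigma> k) \<le> K" "\<And>k. 1 \<le> K * norm (w k $ \<sigma> k)"
      "\<And>k j. j \<noteq> \<sigma> k \<Longrightarrow> norm (w k $ j) \<le> K * e"
    and R: "\<And>i j. norm (d j - d i) \<le> R"
  defines "M \<equiv> (\<chi> k l. scalar_product (w k) (u l))"
  shows "invertible M"
    and "(\<And>k. (M *v x) $ k = scalar_product (w k) (\<chi> j. (d j - d (\<sigma> l)) * u l $ j)) \<Longrightarrow>
      norm (x $ l) \<le> 2 * K\<^sup>2 * (real CARD('n) * (R * K\<^sup>2) + 4 * real CARD('p) * real CARD('n) ^ 2 * R * K ^ 6) * e\<^sup>2"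
proof -
  have "0 \<le> R" using R norm_ge_zero order_trans by blast
  have Ke: "K * e \<le> K" using assms by (simp add: mult_left_le)
  have all: "norm (u k $ j) \<le> K" "norm (w k $ j) \<le> K" for k j
    using u(1)[of k] u(3)[of j k] w(1)[of k] w(3)[of j k] Ke by (cases "j = \<sigma> k"; force)+
  have off: "norm (w k $ j * u l $ j) \<le> K\<^sup>2 * e" if "j \<noteq> \<sigma> k \<or> j \<noteq> \<sigma> l" for k l j
  proof -
    have "norm (w k $ j) * norm (u l $ j) \<le> K * e * K \<or> norm (w k $ j) * norm (u l $ j) \<le> K * (K * e)"
      using that assms(2,3) by (auto intro!: mult_mono all u w)
    then show ?thesis by (auto simp: norm_mult power2_eq_square mult_ac)
  qed
  have diag: "norm (w k $ j * u k $ j) \<le> K\<^sup>2 * e\<^sup>2" if "j \<noteq> \<sigma> k" for k j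
  proof -
    have "norm (w k $ j) * norm (u k $ j) \<le> (K * e) * (K * e)"
      using that assms(2,3) by (intro mult_mono u w) auto
    then show ?thesis by (simp add: norm_mult power2_eq_square mult_ac)
  qed
  \<comment> \<open>The leading product in a diagonal entry of \<open>M\<close> has norm at least
    \<open>1 / K\<^sup>2\<close>; half of this is reserved for the other terms.
    \<open>\<epsilon>\<close> bounds a sum of \<open>CARD('n)\<close> products of size
    \<open>K\<^sup>2 * e\<close>.\<close>
  define \<mu> where "\<mu> = 1 / (2 * K\<^sup>2)"
  define \<epsilon> where "\<epsilon> = real CARD('n) * (K\<^sup>2 * e)"
  have "\<mu> > 0" "\<epsilon> \<ge> 0" using assms by (auto simp: \<mu>_def \<epsilon>_def)
  have "2 * real CARD('p) * \<epsilon> * (2 * K\<^sup>2) = 4 * real CARD('p) * real CARD('n) * K ^ 4 * e"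
    by (simp add: \<epsilon>_def power2_eq_square power4_eq_xxxx)
  with small have \<epsilon>\<mu>: "2 * real CARD('p) * \<epsilon> \<le> \<mu>"
    using assms(2) unfolding \<mu>_def by (subst pos_le_divide_eq) auto
  have "1 \<le> real CARD('p)" by (simp add: Suc_le_eq)
  then have "1 * \<epsilon> \<le> (2 * real CARD('p)) * \<epsilon>"
    using \<open>\<epsilon> \<ge> 0\<close> by (intro mult_right_mono) linarith+
  then have "\<epsilon> \<le> \<mu>" using \<epsilon>\<mu> by linarith
  have Mdiag: "\<mu> \<le> norm (M $ k $ k)" for k
  proof -
    have "1 * 1 \<le> (K * norm (w k $ \<sigma> k)) * (K * norm (u k $ \<sigma> k))"
      using assms(2) by (intro mult_mono u w) auto
    then have "2 * \<mu> \<le> norm (w k $ \<sigma> k * u k $ \<sigma> k)"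
      using assms(2) by (simp add: \<mu>_def norm_mult field_simps power2_eq_square)
    moreover have "norm (\<Sum>j\<in>UNIV - {\<sigma> k}. w k $ j * u k $ j) \<le> (\<Sum>j\<in>UNIV - {\<sigma> k}. K\<^sup>2 * e)"
      by (intro sum_norm_le off) auto
    moreover have "\<dots> \<le> (\<Sum>j\<in>(UNIV :: 'n set). K\<^sup>2 * e)"
      using assms(3) by (intro sum_mono2) auto
    moreover have "M $ k $ k = w k $ \<sigma> k * u k $ \<sigma> k + (\<Sum>j\<in>UNIV - {\<sigma> k}. w k $ j * u k $ j)"
      by (simp add: M_def scalar_product_def sum.remove[of UNIV "\<sigma> k"])
    ultimately show ?thesis
      using \<open>\<epsilon> \<le> \<mu>\<close> norm_diff_ineq[of "w k $ \<sigma> k * u k $ \<sigma> k" "\<Sum>j\<in>UNIV - {\<sigma> k}. w k $ j * u k $ j"]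
      by (simp add: \<epsilon>_def)
  qed
  \<comment> \<open>As \<open>\<sigma>\<close> is injective, every index differs from
    \<open>\<sigma> k\<close> or from \<open>\<sigma> l\<close>, so each product contains a factor
    of size \<open>e\<close>.\<close>
  have Moff: "norm (M $ k $ l) \<le> \<epsilon>" if "l \<noteq> k" for k l
    unfolding M_def \<epsilon>_def using that \<open>inj \<sigma>\<close>
    by (auto intro!: scalar_product_norm_le off dest: injD)
  show "invertible M"
    by (rule diagonally_dominant_invertible[OF \<open>\<mu> > 0\<close> \<open>\<epsilon> \<ge> 0\<close> \<epsilon>\<mu> Mdiag Moff])
  assume x: "\<And>k. (M *v x) $ k = scalar_product (w k) (\<chi> j. (d j - d (\<sigma> l)) * u l $ j)"
  \<comment> \<open>A bound on the product is required only for \<open>j\<close> other than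
    \<open>\<sigma> l\<close>, since the weight vanishes there.\<close>
  have weighted: "norm (w k $ j * ((d j - d (\<sigma> l)) * u l $ j)) \<le> R * B"
    if "j \<noteq> \<sigma> l \<Longrightarrow> norm (w k $ j * u l $ j) \<le> B" "0 \<le> B" for k j B
  proof (cases "j = \<sigma> l")
    case True
    then show ?thesis using \<open>0 \<le> R\<close> that by simp
  next
    case False
    have "norm (w k $ j * ((d j - d (\<sigma> l)) * u l $ j)) = norm (d j - d (\<sigma> l)) * norm (w k $ j * u l $ j)"
      by (simp add: norm_mult)
    also have "\<dots> \<le> R * B" using that False \<open>0 \<le> R\<close> by (intro mult_mono R) auto
    finally show ?thesis .
  qed
  define \<eta> where "\<eta> = real CARD('n) * (R * (K\<^sup>2 * e))"
  have rhs: "norm ((M *v x) $ k) \<le> \<eta>" for k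
    unfolding x \<eta>_def using assms(2,3) by (intro scalar_product_norm_le) (auto intro!: weighted off)
  have "\<mu> * norm (x $ l) \<le> norm ((M *v x) $ l) + \<epsilon> * (2 * real CARD('p) * \<eta> / \<mu>)"
    by (rule diagonally_dominant_bound[OF \<open>\<mu> > 0\<close> \<open>\<epsilon> \<ge> 0\<close> \<epsilon>\<mu> Mdiag Moff rhs])
  also have "norm ((M *v x) $ l) \<le> real CARD('n) * (R * (K\<^sup>2 * e\<^sup>2))"
    unfolding x using assms(2,3) by (intro scalar_product_norm_le) (auto intro!: weighted diag)
  finally have "2 * K\<^sup>2 * (\<mu> * norm (x $ l))
      \<le> 2 * K\<^sup>2 * (real CARD('n) * (R * (K\<^sup>2 * e\<^sup>2)) + \<epsilon> * (2 * real CARD('p) * \<eta> / \<mu>))"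
    using assms(2) by (intro mult_left_mono) auto
  also have "2 * K\<^sup>2 * (\<mu> * norm (x $ l)) = norm (x $ l)"
    using assms(2) by (simp add: \<mu>_def)
  also have "\<epsilon> * (2 * real CARD('p) * \<eta> / \<mu>) = 4 * real CARD('p) * real CARD('n) ^ 2 * R * K ^ 6 * e\<^sup>2"
    by (simp add: \<epsilon>_def \<eta>_def \<mu>_def power2_eq_square eval_nat_numeral)
  finally show "norm (x $ l) \<le> 2 * K\<^sup>2 * (real CARD('n) * (R * K\<^sup>2) + 4 * real CARD('p) * real CARD('n) ^ 2 * R * K ^ 6) * e\<^sup>2"
    by (simp add: algebra_simps)
qed

section \<open>Local quadratic convergence of the DDPSE iteration\<close>

theorem proposition3:
  fixes A :: "real^'n^'n" and P D :: "complex^'n^'n" and b c :: "real^'n"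
    and \<Lambda> :: "complex^'p"
  assumes "invertible P" and "diagonal D"
    and "cmat A = P ** D ** matrix_inv P"
    and "\<forall>s \<in> eigenvalues (cmat A). simple_eigenvalue (cmat A) s"
    and "\<forall>s. s \<notin> eigenvalues (cmat A) \<longrightarrow>
           scalar_product (cvec c) (matrix_inv (cmat A - mat s) *v cvec b) \<noteq> 0"
    and "\<forall>k. scalar_product (cvec c) (P *v axis k 1)
           * scalar_product (axis k 1) (matrix_inv P *v cvec b) \<noteq> 0"
    and "1 \<le> CARD('p)" and "CARD('p) \<le> CARD('n)"
    and "\<forall>k. \<Lambda> $ k \<in> eigenvalues (cmat A)"
    and "inj (\<lambda>k. \<Lambda> $ k)"
  shows "\<exists>V. open V \<and> \<Lambda> \<in> V \<and>
    (\<forall>S0 \<in> V. iteration_converges_quadratically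
       (ddpse_domain (cmat A) P D (cvec b) (cvec c))
       (ddpse_H (cmat A) P D (cvec b) (cvec c)) S0 \<Lambda>)"
proof -
  define d where "d j = D $ j $ j" for j
  define \<beta> where "\<beta> = matrix_inv P *v cvec b"
  define \<gamma> where "\<gamma> = transpose P *v cvec c"
  define u where "u = modal_coords \<beta> \<gamma> d"
  define w where "w = modal_coords \<gamma> \<beta> d"
  let ?A = "cmat A"
  let ?U = "ddpse_domain ?A P D (cvec b) (cvec c) :: (complex^'p) set"
  let ?H = "ddpse_H ?A P D (cvec b) (cvec c) :: complex^'p \<Rightarrow> complex^'p"
  note diag = assms(1,2)
  have f: "ddpse_f ?A P D (cvec b) (cvec c) s = P *v u s" for s
    unfolding assms(3) ddpse_f_modal[OF diag] u_def \<beta>_def \<gamma>_def d_def ..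
  \<comment> \<open>The columns of \<open>P\<close> and of its inverse transpose are dual bases, so
    pairing with \<open>g\<close> becomes pairing of coordinates.\<close>
  have g: "scalar_product (ddpse_g ?A P D (cvec b) (cvec c) s) (P *v y) = scalar_product (w s) y" for s y
  proof -
    have "transpose P *v (transpose (matrix_inv P) *v w s) = w s"
      by (simp only: matrix_vector_mul_assoc flip: matrix_transpose_mul)
        (simp only: matrix_inv_inverse(2)[OF assms(1)] transpose_mat matrix_vector_mul_lid)
    moreover have "ddpse_g ?A P D (cvec b) (cvec c) s = transpose (matrix_inv P) *v w s"
      unfolding assms(3) ddpse_g_modal[OF diag] w_def \<beta>_def \<gamma>_def d_def ..
    ultimately show ?thesis by (simp add: scalar_product_matrix_vector)
  qed
  have "inj d"
    using simple_eigenvalues_inj_diagonal[OF diag] assms(3,4) by (simp add: d_def[abs_def])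
  have nz: "\<gamma> $ j \<noteq> 0" "\<beta> $ j \<noteq> 0" for j
  proof -
    have "scalar_product (cvec c) (P *v axis j 1) = \<gamma> $ j"
      unfolding \<gamma>_def scalar_product_matrix_vector scalar_product_axis ..
    moreover have "scalar_product (axis j 1) (matrix_inv P *v cvec b) = \<beta> $ j"
      using scalar_product_axis[of \<beta> j] by (simp add: \<beta>_def scalar_product_def mult.commute)
    ultimately show "\<gamma> $ j \<noteq> 0" "\<beta> $ j \<noteq> 0"
      using assms(6)[rule_format, of j] by simp_all
  qed
  have "\<forall>k. \<exists>j. \<Lambda> $ k = d j"
    using assms(9) unfolding assms(3) eigenvalues_diagonalized[OF diag] by (auto simp: d_def)
  then obtain \<sigma> where \<sigma>: "\<And>k. \<Lambda> $ k = d (\<sigma> k)" by metis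
  have "inj \<sigma>" using assms(10) by (auto simp: inj_def \<sigma>)

  \<comment> \<open>The flag \<open>t\<close> selects \<open>u\<close> or \<open>w\<close>; a single
    finite index set then yields one constant \<open>K\<close> for all coordinates of both
    families.\<close>
  define Q where "Q = (\<lambda>(k, j, t) C (S :: complex^'p).
    let v = norm ((if t then u else w) (S $ k) $ j) in
    if j = \<sigma> k then v \<le> C \<and> 1 \<le> C * v else v \<le> C * norm (S - \<Lambda>))"
  have "\<exists>K\<ge>1. \<forall>\<^sub>F S in nhds \<Lambda>. \<forall>i\<in>UNIV. Q i K S"
  proof (rule eventually_uniform_bound)
    fix i :: "'p \<times> 'n \<times> bool"
    obtain k j t where i: "i = (k, j, t)" by (cases i) auto
    let ?v = "\<lambda>s. norm ((if t then u else w) s $ j)"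
    have "\<exists>C. \<forall>\<^sub>F s in nhds (d (\<sigma> k)).
        if j = \<sigma> k then ?v s \<le> C \<and> 1 \<le> C * ?v s else ?v s \<le> C * norm (s - d (\<sigma> k))"
      unfolding u_def w_def using modal_coords_bounds[OF \<open>inj d\<close>] nz by (cases t) auto
    then obtain C where C: "\<forall>\<^sub>F s in nhds (d (\<sigma> k)).
        if j = \<sigma> k then ?v s \<le> C \<and> 1 \<le> C * ?v s else ?v s \<le> C * norm (s - d (\<sigma> k))" ..
    have "filterlim (\<lambda>S. S $ k) (nhds (d (\<sigma> k))) (nhds \<Lambda>)"
      unfolding \<sigma>[symmetric] by (intro tendsto_vec_nth filterlim_ident)
    with C have "\<forall>\<^sub>F S in nhds \<Lambda>.
        if j = \<sigma> k then ?v (S $ k) \<le> C \<and> 1 \<le> C * ?v (S $ k) else ?v (S $ k) \<le> C * norm (S $ k - d (\<sigma> k))"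
      by (rule eventually_compose_filterlim)
    \<comment> \<open>Passing from one component of \<open>S - \<Lambda>\<close> to its full norm
      requires a nonnegative constant, hence the absolute value.\<close>
    then have "\<forall>\<^sub>F S in nhds \<Lambda>. Q i \<bar>C\<bar> S"
    proof eventually_elim
      case (elim S)
      have "norm (S $ k - d (\<sigma> k)) \<le> norm (S - \<Lambda>)"
        using Finite_Cartesian_Product.norm_nth_le[of "S - \<Lambda>" k] by (simp add: \<sigma>)
      then have "C * norm (S $ k - d (\<sigma> k)) \<le> \<bar>C\<bar> * norm (S - \<Lambda>)"
        by (intro mult_mono) auto
      moreover have "C * ?v (S $ k) \<le> \<bar>C\<bar> * ?v (S $ k)" by (intro mult_right_mono) auto
      ultimately show ?case using elim unfolding i Q_def by (auto simp: Let_def split: if_splits)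
    qed
    then show "\<exists>C. \<forall>\<^sub>F S in nhds \<Lambda>. Q i C S" ..
  next
    fix i :: "'p \<times> 'n \<times> bool" and S C C'
    assume "Q i C S" and "C \<le> C'"
    moreover from this(2) have "C * norm y \<le> C' * norm y" for y :: "complex^'p"
      by (intro mult_right_mono) auto
    moreover from \<open>C \<le> C'\<close> have "C * norm y \<le> C' * norm y" for y :: complex
      by (intro mult_right_mono) auto
    ultimately show "Q i C' S"
      unfolding Q_def by (auto simp: Let_def split: prod.splits if_splits intro: order_trans)
  qed simp
  then obtain K where K: "K \<ge> 1" "\<forall>\<^sub>F S in nhds \<Lambda>. \<forall>i. Q i K S" by auto

  define R where "R = Max (range (\<lambda>(i, j). norm (d j - d i)))"
  have R: "norm (d j - d i) \<le> R" for i j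
    unfolding R_def by (rule Max_ge) (auto intro: rev_image_eqI[of "(i, j)"])
  define B where "B = 2 * K\<^sup>2 * (real CARD('n) * (R * K\<^sup>2) + 4 * real CARD('p) * real CARD('n) ^ 2 * R * K ^ 6)"
  \<comment> \<open>Below this threshold the smallness hypothesis of
    \<open>modal_residual_bound\<close> holds.\<close>
  define r where "r = 1 / (4 * real CARD('p) * real CARD('n) * K ^ 4)"
  have "((\<lambda>S. norm (S - \<Lambda>)) \<longlongrightarrow> norm (\<Lambda> - \<Lambda>)) (nhds \<Lambda>)"
    by (intro tendsto_intros filterlim_ident)
  moreover have "0 < min 1 r" using K(1) by (simp add: r_def)
  ultimately have "\<forall>\<^sub>F S in nhds \<Lambda>. norm (S - \<Lambda>) < min 1 r"
    by (intro order_tendstoD) auto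
  with K(2) have "\<forall>\<^sub>F S in nhds \<Lambda>. S \<in> ?U \<and> norm (?H S - \<Lambda>) \<le> real CARD('p) * B * (norm (S - \<Lambda>))\<^sup>2"
  proof eventually_elim
    case (elim S)
    let ?e = "norm (S - \<Lambda>)" and ?M = "\<chi> k l. scalar_product (w (S $ k)) (u (S $ l))"
    have small: "4 * real CARD('p) * real CARD('n) * K ^ 4 * ?e \<le> 1"
      using elim(2) K(1) by (simp add: r_def field_simps)
    have Qu: "Q (k, j, True) K S" and Qw: "Q (k, j, False) K S" for k j using elim(1) by auto
    have bounds: "norm (u (S $ k) $ \<sigma> k) \<le> K" "1 \<le> K * norm (u (S $ k) $ \<sigma> k)"
      "j \<noteq> \<sigma> k \<Longrightarrow> norm (u (S $ k) $ j) \<le> K * ?e"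
      "norm (w (S $ k) $ \<sigma> k) \<le> K" "1 \<le> K * norm (w (S $ k) $ \<sigma> k)"
      "j \<noteq> \<sigma> k \<Longrightarrow> norm (w (S $ k) $ j) \<le> K * ?e" for k j
      using Qu[of k "\<sigma> k"] Qu[of k j] Qw[of k "\<sigma> k"] Qw[of k j] by (simp_all add: Q_def Let_def)
    have e: "0 \<le> ?e" "?e \<le> 1" using elim(2) by auto
    note mrb = modal_residual_bound[where d = d and u = "\<lambda>k. u (S $ k)" and w = "\<lambda>k. w (S $ k)",
        OF \<open>inj \<sigma>\<close> K(1) e small bounds R]
    have "transpose (ddpse_Y ?A P D (cvec b) (cvec c) S) ** ddpse_X ?A P D (cvec b) (cvec c) S
      = (\<chi> k l. scalar_product (ddpse_g ?A P D (cvec b) (cvec c) (S $ k)) (ddpse_f ?A P D (cvec b) (cvec c) (S $ l)))"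
      by (simp add: vec_eq_iff scalar_product_def matrix_matrix_mult_def transpose_def
        ddpse_X_def ddpse_Y_def)
    also have "\<dots> = ?M" by (simp add: f g)
    finally have "S \<in> ?U" using mrb(1) by (simp add: ddpse_domain_def)
    moreover have "norm (?H S $ l - \<Lambda> $ l) \<le> B * ?e\<^sup>2" for l
    proof -
      \<comment> \<open>These are the eigenvector coordinates of the residual of \<open>f\<close> at
        \<open>S $ l\<close> for the eigenvalue \<open>\<Lambda> $ l\<close>.\<close>
      have "(\<chi> j. (d j - d (\<sigma> l)) * u (S $ l) $ j) = D *v u (S $ l) - \<Lambda> $ l *s u (S $ l)"
        by (simp add: diagonal_vector_mult[OF assms(2)] vec_eq_iff \<sigma> left_diff_distrib d_def)
      then have res: "?A *v (P *v u (S $ l)) - \<Lambda> $ l *s (P *v u (S $ l))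
          = P *v (\<chi> j. (d j - d (\<sigma> l)) * u (S $ l) $ j)"
        using diagonalized_shift_mult[OF assms(1), of D "\<Lambda> $ l" "u (S $ l)"]
        by (simp add: assms(3) matrix_vector_mult_diff_rdistrib mat_vector_mult)
      obtain x where "x $ l = ?H S $ l - \<Lambda> $ l"
        "\<And>k. (?M *v x) $ k = scalar_product (w (S $ k)) (\<chi> j. (d j - d (\<sigma> l)) * u (S $ l) $ j)"
        using ddpse_H_residual[OF \<open>S \<in> ?U\<close>, of l "\<Lambda> $ l"] unfolding f res g by blast
      then show ?thesis using mrb(2)[of x l] by (simp add: B_def)
    qed
    \<comment> \<open>The Euclidean norm is at most the sum of the component norms, which accounts
      for the factor \<open>CARD('p)\<close>.\<close>
    then have "(\<Sum>l\<in>UNIV. norm ((?H S - \<Lambda>) $ l)) \<le> (\<Sum>l\<in>(UNIV::'p set). B * ?e\<^sup>2)"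
      by (intro sum_mono) simp
    then have "norm (?H S - \<Lambda>) \<le> real CARD('p) * B * ?e\<^sup>2"
      using L2_set_le_sum[of UNIV "\<lambda>l. norm ((?H S - \<Lambda>) $ l)"] by (simp add: norm_vec_def)
    ultimately show ?case by blast
  qed
  then show ?thesis by (rule quadratic_contraction_converges)
qed

end
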